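(* Let $n\ge 2$ and consider a reversed periscope in $\mathbb{R}^n=\mathbb{R}^{n-1}\times\mathbb{R}$ whose mirrors are graphs of functions $f$ and $g$, with associated local diffeomorphism $T:x\mapsto y$ of $\mathbb{R}^{n-1}$ defined on $W\subset\mathbb{R}^{n-1}$. Then there is a positive constant $C$ such that for every $x\in W$ and $y=T(x)$ one has $$g(y)=\frac{f(x)-C\left(1-|\nabla f(x)|^2\right)}{|\nabla f(x)|^2}$$ and $$T(x)=x+\frac{2(C-f(x))}{|\nabla f(x)|^2}\,\nabla f(x).$$
   Context: Reversed periscope: regard $\mathbb{R}^n$ as $\mathbb{R}^{n-1}\times\mathbb{R}$, with the last coordinate axis vertical and $e=(0,1)$ the upward unit vector. Vertical rays are parameterized by points of the horizontal hyperplane $\mathbb{R}^{n-1}=\mathbb{R}^{n-1}\times\{0\}$. A reversed periscope is a system of two mirrors such that every upward vertical ray starting at a point $x$ of some (connected) open set $W\subset\mathbb{R}^{n-1}$ reflects consecutively in the two mirrors and becomes a downward vertical ray, arriving at a point $y=T(x)\in\mathbb{R}^{n-1}$; $T:W\to T(W)\subset\mathbb{R}^{n-1}$ is a diffeomorphism onto an open set. The mirrors are the graphs of smooth functions $f:W\to\mathbb{R}$ and $g:T(W)\to\mathbb{R}$, lying above the hyperplane $\mathbb{R}^{n-1}$ (so $f,g>0$). For $x\in W$ and $y=T(x)$: the upward ray from $x$ hits the first mirror at $P=(x,f(x))$ and reflects to the ray from $P$ towards $Q=(y,g(y))\neq P$, i.e. $u=(Q-P)/|Q-P|$ is the image of $e$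 under the linear reflection in the tangent hyperplane of the first mirror at $P$; this ray hits the second mirror at $Q$ and reflects to the downward ray from $Q$ to $y$, i.e. $-e$ is the image of $u$ under the linear reflection in the tangent hyperplane of the second mirror at $Q$. Standing convention: the point $P$ is not lower than the point $Q$, i.e. $f(x)\ge g(T(x))$ (otherwise one reverses the directions of the rays and interchanges $x$ and $y$). *)

theory Defs
  imports "HOL-Analysis.Analysis"
begin

text \<open>
  For open \<open>S\<close> and finite-dimensional \<open>'a\<close>, \<open>ck_on S f k\<close> says that \<open>f\<close> is of class \<open>C\<^sup>k\<close> on \<open>S\<close>:
  all iterated directional derivatives up to order \<open>k\<close> exist and are continuous.
\<close>

fun ck_on :: "'a::real_normed_vector set \<Rightarrow> ('a \<Rightarrow> 'b::real_normed_vector) \<Rightarrow> nat \<Rightarrow> bool" where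
  "ck_on S f 0 \<longleftrightarrow> continuous_on S f"
| "ck_on S f (Suc k) \<longleftrightarrow>
     (\<forall>x\<in>S. f differentiable (at x)) \<and>
     (\<forall>v. ck_on S (\<lambda>x. frechet_derivative f (at x) v) k)"

definition smooth_on :: "'a::real_normed_vector set \<Rightarrow> ('a \<Rightarrow> 'b::real_normed_vector) \<Rightarrow> bool" where
  "smooth_on S f \<longleftrightarrow> (\<forall>k. ck_on S f k)"

definition diffeo_onto_open ::
    "'a::real_normed_vector set \<Rightarrow> ('a \<Rightarrow> 'b::real_normed_vector) \<Rightarrow> bool" where
  "diffeo_onto_open W T \<longleftrightarrow>
     open (T ` W) \<and> inj_on T W \<and> smooth_on W T \<and> smooth_on (T ` W) (inv_into W T)"

definition grad :: "('a::euclidean_space \<Rightarrow> real) \<Rightarrow> 'a \<Rightarrow> 'a" where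
  "grad f x = (THE D. GDERIV f x :> D)"

text \<open>The linear direction space of the tangent hyperplane to the graph of \<open>f\<close> at \<open>(x, f x)\<close>.\<close>

definition tangent_hyperplane ::
    "('a::euclidean_space \<Rightarrow> real) \<Rightarrow> 'a \<Rightarrow> ('a \<times> real) set" where
  "tangent_hyperplane f x = range (\<lambda>v. (v, frechet_derivative f (at x) v))"

text \<open>
  For a linear subspace \<open>H\<close>, \<open>closest_point H\<close> is the orthogonal projection onto \<open>H\<close>.
\<close>

definition reflect_in :: "'a::euclidean_space set \<Rightarrow> 'a \<Rightarrow> 'a" where
  "reflect_in H v = 2 *\<^sub>R closest_point H v - v"

lemma grad_eq:
  assumes "GDERIV f x :> D"
  shows "grad f x = D"
  unfolding grad_def
proof (rule the_equality)
  show "GDERIV f x :> D" by fact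
next
  fix D' assume "GDERIV f x :> D'"
  then have "(\<lambda>h. h \<bullet> D') = (\<lambda>h. h \<bullet> D)"
    using assms unfolding gderiv_def by (rule has_derivative_unique)
  then show "D' = D"
    by (metis vector_eq_ldot)
qed

lemma gderiv_grad:
  assumes "f differentiable (at x)"
  shows "GDERIV f x :> grad f x"
proof -
  obtain f' where f': "(f has_derivative f') (at x)"
    using assms by (auto simp: differentiable_def)
  then have "linear f'" by (rule has_derivative_linear)
  then have "f' = (\<lambda>h. h \<bullet> adjoint f' 1)"
    using adjoint_works[of f' _ 1] by (auto simp: inner_real_def)
  then have "GDERIV f x :> adjoint f' 1"
    using f' by (simp add: gderiv_def)
  then show ?thesis using grad_eq by metis
qed

lemma frechet_derivative_eq_grad:
  assumes "f differentiable (at x)"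
  shows "frechet_derivative f (at x) v = v \<bullet> grad f x"
  using gderiv_grad[OF assms] frechet_derivative_at unfolding gderiv_def by metis

lemma reflect_in_tangent_hyperplane:
  fixes f :: "'a::euclidean_space \<Rightarrow> real"
  assumes "f differentiable (at x)"
  defines "N \<equiv> (- grad f x, 1)"
  shows "reflect_in (tangent_hyperplane f x) v = v - (2 * (v \<bullet> N) / (N \<bullet> N)) *\<^sub>R N"
proof -
  have "N \<bullet> N = (norm (grad f x))\<^sup>2 + 1"
    by (simp add: N_def power2_norm_eq_inner)
  then have NN: "N \<bullet> N > 0"
    by (simp add: add_nonneg_pos)
  have T: "tangent_hyperplane f x = {w. N \<bullet> w = 0}"
    by (auto simp: tangent_hyperplane_def frechet_derivative_eq_grad[OF assms(1)] N_def
        inner_commute image_iff)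
  define p where "p = v - ((v \<bullet> N) / (N \<bullet> N)) *\<^sub>R N"
  have vp: "v - p = ((v \<bullet> N) / (N \<bullet> N)) *\<^sub>R N"
    by (simp add: p_def)
  have p0: "N \<bullet> p = 0"
    using NN by (simp add: p_def inner_diff_right inner_commute)
  have "p = closest_point {w. N \<bullet> w = 0} v"
  proof (rule closest_point_unique)
    show "convex {w. N \<bullet> w = 0}" by (rule convex_hyperplane)
    show "closed {w. N \<bullet> w = 0}" by (rule closed_hyperplane)
    show "p \<in> {w. N \<bullet> w = 0}" using p0 by simp
    show "\<forall>z\<in>{w. N \<bullet> w = 0}. dist v p \<le> dist v z"
    proof
      fix z assume "z \<in> {w. N \<bullet> w = 0}"
      then have "orthogonal (v - p) (p - z)"
        using p0 by (simp add: orthogonal_def inner_diff_right vp)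
      then have "(norm (v - z))\<^sup>2 = (norm (v - p))\<^sup>2 + (norm (p - z))\<^sup>2"
        using norm_add_Pythagorean by fastforce
      then show "dist v p \<le> dist v z"
        by (simp add: dist_norm power2_le_imp_le)
    qed
  qed
  then have "reflect_in (tangent_hyperplane f x) v = 2 *\<^sub>R p - v"
    by (simp add: reflect_in_def T)
  also have "\<dots> = v - (2 * ((v \<bullet> N) / (N \<bullet> N))) *\<^sub>R N"
    unfolding p_def scaleR_diff_right scaleR_scaleR by (simp add: scaleR_2)
  finally show ?thesis by simp
qed

text \<open>
  Euclidean \<open>n\<close>-space is \<open>(real ^ 'm) \<times> real\<close> with \<open>n = CARD('m) + 1\<close>, the second component being
  the height and \<open>(0, 1)\<close> the upward unit vector.
\<close>

definition reversed_periscope ::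
    "(real ^ 'm) set \<Rightarrow> (real ^ 'm \<Rightarrow> real) \<Rightarrow> (real ^ 'm \<Rightarrow> real) \<Rightarrow> (real ^ 'm \<Rightarrow> real ^ 'm) \<Rightarrow> bool"
  where
  "reversed_periscope W f g T \<longleftrightarrow>
     open W \<and> connected W \<and> diffeo_onto_open W T \<and>
     smooth_on W f \<and> smooth_on (T ` W) g \<and>
     (\<forall>x\<in>W. f x > 0) \<and> (\<forall>y\<in>T ` W. g y > 0) \<and>
     (\<forall>x\<in>W.
        let y = T x; P = (x, f x); Q = (y, g y); u = (Q - P) /\<^sub>R norm (Q - P) in
          Q \<noteq> P \<and>
          reflect_in (tangent_hyperplane f x) (0, 1) = u \<and>
          reflect_in (tangent_hyperplane g y) u = - (0, 1))"

end

theory Submission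
  imports Defs
begin

text \<open>
  The formulas are a consequence of the conservation of optical path length. Let \<open>P\<close> and \<open>Q\<close> be the
  two points of reflection on the ray issued from \<open>x\<close>, let \<open>L\<close> be their distance and \<open>u\<close> the direction
  from \<open>P\<close> to \<open>Q\<close>. A reflection preserves the component of a vector along the mirror
  (\<open>reflect_in_preserves_tangential_component\<close>). So when \<open>x\<close> varies, \<open>P\<close> moves with a velocity on
  which the upward vector \<open>e\<close> and \<open>u\<close> have the same inner product, and \<open>Q\<close> moves with a velocity
  on which \<open>u\<close> and \<open>- e\<close> have the same inner product. The three derivatives of the path length
  \<open>f x + L + g (T x)\<close> then cancel, and as \<open>W\<close> is connected this length is a constant, which is
  called \<open>2 * C\<close> (\<open>optical_path_length_constant\<close>).

  The law of reflection at \<open>P\<close> expresses \<open>u\<close> through the gradient of \<open>f\<close>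
  (\<open>reflect_in_vertical\<close>). It determines \<open>Q\<close> from \<open>P\<close> up to the unknown \<open>L\<close>, and the
  value of the path length determines \<open>L\<close>. Division by the square of the gradient of \<open>f\<close> is
  legitimate: where the gradient vanishes, the ray would return vertically downwards, and a mirror
  that is a graph cannot leave a vertical ray unchanged.
\<close>

section \<open>Reflection in the tangent hyperplane of a graph\<close>

text \<open>
  The two vectors differ by a multiple of the normal vector \<open>(- grad f x, 1)\<close>, to which
  \<open>(h, h \<bullet> grad f x)\<close> is orthogonal.
\<close>

lemma reflect_in_preserves_tangential_component:
  fixes f :: "'a::euclidean_space \<Rightarrow> real"
  assumes "f differentiable (at x)"
  shows "reflect_in (tangent_hyperplane f x) v \<bullet> (h, h \<bullet> grad f x) = v \<bullet> (h, h \<bullet> grad f x)"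
proof -
  have "(- grad f x, 1) \<bullet> (h, h \<bullet> grad f x) = 0"
    by (simp add: inner_commute)
  then show ?thesis
    unfolding reflect_in_tangent_hyperplane[OF assms] inner_diff_left inner_scaleR_left by simp
qed

lemma reflect_in_vertical:
  fixes f :: "'a::euclidean_space \<Rightarrow> real"
  assumes "f differentiable (at x)"
  defines "s \<equiv> (norm (grad f x))\<^sup>2"
  shows "reflect_in (tangent_hyperplane f x) (0, 1) = ((2 / (1 + s)) *\<^sub>R grad f x, (s - 1) / (1 + s))"
proof -
  have "1 + s > 0"
    by (simp add: s_def add_pos_nonneg)
  moreover have "s = grad f x \<bullet> grad f x"
    by (simp add: s_def power2_norm_eq_inner)
  ultimately show ?thesis
    by (simp add: reflect_in_tangent_hyperplane[OF assms(1)] field_simps)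
qed

text \<open>
  The fixed vectors of the reflection are tangent to the graph, and no vertical vector is.
\<close>

lemma reflect_in_vertical_neq:
  fixes f :: "'a::euclidean_space \<Rightarrow> real"
  assumes "f differentiable (at x)" "c \<noteq> 0"
  shows "reflect_in (tangent_hyperplane f x) (0, c) \<noteq> (0, c)"
proof -
  have "1 + grad f x \<bullet> grad f x > 0"
    by (simp add: add_pos_nonneg)
  then show ?thesis
    using assms(2) by (auto simp: reflect_in_tangent_hyperplane[OF assms(1)])
qed

section \<open>Geometry of a reversed periscope\<close>

lemma smooth_on_imp_differentiable:
  "smooth_on S f \<Longrightarrow> x \<in> S \<Longrightarrow> f differentiable (at x)"
  unfolding smooth_on_def by (metis ck_on.simps(2))

text \<open>
  The displacement from the first point of reflection to the second one; its norm is the length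
  of the middle segment of the ray.
\<close>

definition middle_segment ::
    "('a::euclidean_space \<Rightarrow> real) \<Rightarrow> ('a \<Rightarrow> real) \<Rightarrow> ('a \<Rightarrow> 'a) \<Rightarrow> 'a \<Rightarrow> 'a \<times> real" where
  "middle_segment f g T x = (T x - x, g (T x) - f x)"

definition optical_path_length ::
    "('a::euclidean_space \<Rightarrow> real) \<Rightarrow> ('a \<Rightarrow> real) \<Rightarrow> ('a \<Rightarrow> 'a) \<Rightarrow> 'a \<Rightarrow> real" where
  "optical_path_length f g T x = f x + norm (middle_segment f g T x) + g (T x)"

lemma reversed_periscopeD:
  assumes "reversed_periscope W f g T" "x \<in> W"
  shows "f differentiable (at x)" "g differentiable (at (T x))" "T differentiable (at x)"
    and "middle_segment f g T x \<noteq> 0"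
    and "reflect_in (tangent_hyperplane f x) (0, 1) = sgn (middle_segment f g T x)"
    and "reflect_in (tangent_hyperplane g (T x)) (sgn (middle_segment f g T x)) = (0, - 1)"
  using assms
  by (auto simp: reversed_periscope_def diffeo_onto_open_def Let_def middle_segment_def sgn_div_norm
      zero_prod_def intro: smooth_on_imp_differentiable)

text \<open>
  The derivative of the length of the middle segment is the inner product of its direction \<open>u\<close> with
  the difference of the velocities of its endpoints. By the two laws of reflection, \<open>u\<close> may be
  replaced by the upward vector at the first endpoint and by the downward vector at the second one,
  which turns the two contributions into the opposites of the derivatives of the two heights.
\<close>

lemma optical_path_length_has_derivative_zero:
  assumes periscope: "reversed_periscope W f g T" and x: "x \<in> W"
  shows "(optical_path_length f g T has_derivative (\<lambda>h. 0)) (at x)"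
proof -
  note D = reversed_periscopeD[OF periscope x]
  define u where "u = sgn (middle_segment f g T x)"
  obtain T' where T': "(T has_derivative T') (at x)"
    using D(3) by (auto simp: differentiable_def)
  have f': "(f has_derivative (\<lambda>h. h \<bullet> grad f x)) (at x)"
    using gderiv_grad[OF D(1)] by (simp add: gderiv_def)
  have "(g has_derivative (\<lambda>h. h \<bullet> grad g (T x))) (at (T x))"
    using gderiv_grad[OF D(2)] by (simp add: gderiv_def)
  then have g': "((\<lambda>x. g (T x)) has_derivative (\<lambda>h. T' h \<bullet> grad g (T x))) (at x)"
    by (rule has_derivative_compose[OF T'])
  have "(middle_segment f g T has_derivative
      (\<lambda>h. (T' h - h, T' h \<bullet> grad g (T x) - h \<bullet> grad f x))) (at x)"
    unfolding middle_segment_def by (intro derivative_intros T' f' g')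
  moreover have "(norm has_derivative (\<lambda>h. h \<bullet> u)) (at (middle_segment f g T x))"
    unfolding u_def using has_derivative_norm[OF D(4)] by simp
  ultimately have norm': "((\<lambda>x. norm (middle_segment f g T x)) has_derivative
      (\<lambda>h. (T' h - h, T' h \<bullet> grad g (T x) - h \<bullet> grad f x) \<bullet> u)) (at x)"
    by (rule has_derivative_compose)
  have "h \<bullet> grad f x + (T' h - h, T' h \<bullet> grad g (T x) - h \<bullet> grad f x) \<bullet> u
      + T' h \<bullet> grad g (T x) = 0" for h
  proof -
    have "(T' h - h, T' h \<bullet> grad g (T x) - h \<bullet> grad f x) \<bullet> u =
        u \<bullet> (T' h, T' h \<bullet> grad g (T x)) - u \<bullet> (h, h \<bullet> grad f x)"
      by (metis diff_Pair inner_commute inner_diff_right)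
    moreover have "u \<bullet> (h, h \<bullet> grad f x) = h \<bullet> grad f x"
      using reflect_in_preserves_tangential_component[OF D(1), of "(0, 1)" h]
      by (simp add: D(5) u_def)
    moreover have "u \<bullet> (T' h, T' h \<bullet> grad g (T x)) = - (T' h \<bullet> grad g (T x))"
      using reflect_in_preserves_tangential_component[OF D(2), of u "T' h"]
      by (simp add: D(6) u_def)
    ultimately show ?thesis
      by simp
  qed
  then show ?thesis
    unfolding optical_path_length_def
    using has_derivative_add[OF has_derivative_add[OF f' norm'] g'] by simp
qed

lemma optical_path_length_constant:
  assumes "reversed_periscope W f g T"
  obtains c where "\<And>x. x \<in> W \<Longrightarrow> optical_path_length f g T x = c"
proof -
  have "open W" "connected W"
    using assms by (auto simp: reversed_periscope_def)
  then show ?thesis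
    using has_derivative_zero_unique_connected[of W "optical_path_length f g T"]
      optical_path_length_has_derivative_zero[OF assms] that
    by metis
qed

lemma grad_first_mirror_nonzero:
  assumes periscope: "reversed_periscope W f g T" and x: "x \<in> W"
  shows "grad f x \<noteq> 0"
proof
  note D = reversed_periscopeD[OF periscope x]
  assume "grad f x = 0"
  then have "sgn (middle_segment f g T x) = (0, - 1)"
    using reflect_in_vertical[OF D(1)] D(5) by simp
  then show False
    using D(6) reflect_in_vertical_neq[OF D(2), of "- 1"] by simp
qed

text \<open>
  The law of reflection at the first mirror gives the middle segment in terms of its length \<open>L\<close> and
  of \<open>s = (norm (grad f x))\<^sup>2\<close>. The path length is then \<open>2 * f x + 2 * s * L / (1 + s)\<close>, and
  elimination of \<open>L\<close> leaves the two formulas.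
\<close>

lemma reversed_periscope_formulas:
  assumes periscope: "reversed_periscope W f g T" and x: "x \<in> W"
    and C: "optical_path_length f g T x = 2 * C"
  shows "g (T x) = (f x - C * (1 - (norm (grad f x))\<^sup>2)) / (norm (grad f x))\<^sup>2"
    and "T x = x + (2 * (C - f x) / (norm (grad f x))\<^sup>2) *\<^sub>R grad f x"
proof -
  note D = reversed_periscopeD[OF periscope x]
  define s where "s = (norm (grad f x))\<^sup>2"
  define L where "L = norm (middle_segment f g T x)"
  have s: "s > 0"
    using grad_first_mirror_nonzero[OF periscope x] by (simp add: s_def)
  have "middle_segment f g T x = L *\<^sub>R sgn (middle_segment f g T x)"
    using D(4) by (simp add: L_def sgn_div_norm)
  also have "\<dots> = L *\<^sub>R ((2 / (1 + s)) *\<^sub>R grad f x, (s - 1) / (1 + s))"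
    using reflect_in_vertical[OF D(1)] by (simp add: D(5) s_def)
  finally have T: "T x - x = (2 * L / (1 + s)) *\<^sub>R grad f x"
    and g: "g (T x) - f x = L * (s - 1) / (1 + s)"
    by (simp_all add: middle_segment_def mult.commute)
  have "2 * (C - f x) = L + (g (T x) - f x)"
    using C by (simp add: optical_path_length_def L_def)
  then have L: "C - f x = L * s / (1 + s)"
    using s g by (simp add: field_simps)
  have "2 * (C - f x) / s = 2 * L / (1 + s)"
    using s by (simp add: L)
  then show "T x = x + (2 * (C - f x) / (norm (grad f x))\<^sup>2) *\<^sub>R grad f x"
    using T by (simp add: s_def algebra_simps)
  have "g (T x) = f x + (C - f x) * (s - 1) / s"
    using g s by (simp add: L)
  also have "\<dots> = (f x - C * (1 - s)) / s"
    using s by (simp add: field_simps)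
  finally show "g (T x) = (f x - C * (1 - (norm (grad f x))\<^sup>2)) / (norm (grad f x))\<^sup>2"
    by (simp add: s_def)
qed

section \<open>The mirrors of a reversed periscope\<close>

theorem theorem3:
  fixes W :: "(real ^ 'm) set"
    and f g :: "real ^ 'm \<Rightarrow> real"
    and T :: "real ^ 'm \<Rightarrow> real ^ 'm"
  assumes periscope: "reversed_periscope W f g T"
    and not_lower: "\<forall>x\<in>W. f x \<ge> g (T x)"
  shows "\<exists>C>0. \<forall>x\<in>W.
           g (T x) = (f x - C * (1 - (norm (grad f x))\<^sup>2)) / (norm (grad f x))\<^sup>2 \<and>
           T x = x + (2 * (C - f x) / (norm (grad f x))\<^sup>2) *\<^sub>R grad f x"
proof (cases "W = {}")
  case True
  then show ?thesis
    by (auto intro: exI[of _ 1])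
next
  case False
  then obtain x where x: "x \<in> W"
    by blast
  obtain c where c: "\<And>x. x \<in> W \<Longrightarrow> optical_path_length f g T x = c"
    using optical_path_length_constant[OF periscope] by blast
  have "f x > 0" "g (T x) > 0"
    using periscope x by (auto simp: reversed_periscope_def)
  then have "optical_path_length f g T x > 0"
    by (simp add: optical_path_length_def add_pos_nonneg add_pos_pos)
  then have "c / 2 > 0"
    using c[OF x] by simp
  moreover have "optical_path_length f g T z = 2 * (c / 2)" if "z \<in> W" for z
    using c[OF that] by simp
  ultimately show ?thesis
    using reversed_periscope_formulas[OF periscope] by blast
qed

end
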